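(* In CCSK, equipped with its proved labelled transition system, let $T_1$ and $T_2$ be two traces (between reachable processes) that are coinitial (they have the same source) and cofinal (they have the same target). Then $T_1$ and $T_2$ are causally equivalent, i.e. $T_1 \sim T_2$.
   Context: **Syntax of CCSK.** Let $\mathsf N=\{a,b,c,\dots\}$ be a set of names, $\overline{\mathsf N}=\{\bar a,\bar b,\bar c,\dots\}$ the set of co-names, with a bijection $\overline{\,\cdot\,}:\mathsf N\to\overline{\mathsf N}$ whose inverse is also written $\overline{\,\cdot\,}$. Labels: $\mathsf L=\mathsf N\cup\overline{\mathsf N}\cup\{\tau\}$; $\alpha,\beta$ range over $\mathsf L$ and $\lambda$ over $\mathsf L\setminus\{\tau\}$. Let $\mathsf K=\{m,n,\dots\}$ be a set of keys, ranged over by $k$. Processes: $X,Y ::= 0 \mid \alpha.X \mid \alpha[k].X \mid X\backslash a \mid X+Y \mid (X\mid Y)$. $\mathrm{key}(X)$ is the set of keys occurring in $X$; $X$ is standard, $\mathrm{std}(X)$, iff $\mathrm{key}(X)=\emptyset$. **Enhanced keyed labels.** With $\upsilon,\upsilon_L,\upsilon_R$ strings in $\{|_L,|_R\}^*$: $\theta ::= \upsilon\alpha[k]$ or $\upsilon\langle |_L\upsilon_L\alpha[k],\ |_R\upsilon_R\bar\alpha[k]\rangle$. Put $\ell(\upsilon\alpha[k])=\alpha$, $\ell$ of the second form $=\tau$, and $\kappa(\theta)=k$ in both cases. **Proved LTS.** Forward transitions $X\xrightarrow{\theta}X'$ are inductively generated by: - (act.) $\alpha.X\xrightarrow{\alpha[k]}\alpha[k].X$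 if $\mathrm{std}(X)$; - (pre.) $\alpha[k].X\xrightarrow{\theta}\alpha[k].X'$ if $X\xrightarrow{\theta}X'$ and $\kappa(\theta)\neq k$; - (res.) $X\backslash a\xrightarrow{\theta}X'\backslash a$ if $X\xrightarrow{\theta}X'$ and $\ell(\theta)\notin\{a,\bar a\}$; - ($|_L$) $X\mid Y\xrightarrow{|_L\theta}X'\mid Y$ if $X\xrightarrow{\theta}X'$ and $\kappa(\theta)\notin\mathrm{key}(Y)$; ($|_R$) symmetrically, $X\mid Y\xrightarrow{|_R\theta}X\mid Y'$ if $Y\xrightarrow{\theta}Y'$ and $\kappa(\theta)\notin\mathrm{key}(X)$; - (syn.) $X\mid Y\xrightarrow{\langle |_L\upsilon_L\lambda[k],\,|_R\upsilon_R\bar\lambda[k]\rangle}X'\mid Y'$ if $X\xrightarrow{\upsilon_L\lambda[k]}X'$ and $Y\xrightarrow{\upsilon_R\bar\lambda[k]}Y'$; - ($+_L$) $X+Y\xrightarrow{\theta}X'+Y$ if $X\xrightarrow{\theta}X'$ and $\mathrm{std}(Y)$; ($+_R$) symmetrically. Backward transitions $X'\overset{\theta}{\rightsquigarrow}X$ are generated by the exact symmetric rules (source and target exchanged in premises and conclusion, same labels and side conditions). Write $X\overset{\theta}{\twoheadrightarrow}Y$ if $X\xrightarrow{\theta}Y$ or $X\overset{\theta}{\rightsquigarrow}Y$. A process $X$ is reachable if there is a standard $O_X$ from which $X$ is reached by a finite sequence of $\twoheadrightarrow$-steps. All processes considered are reachable. **Transitions and traces.** A transition is $t:X\overset{\theta}{\twoheadrightarrow}X'$,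 forward or backward, with source $X$ and target $X'$. The reverse $t^\bullet$ of a forward $t:X\xrightarrow{\theta}X'$ is $t^\bullet:X'\overset{\theta}{\rightsquigarrow}X$, and conversely, so $(t^\bullet)^\bullet=t$. Transitions $t_1,t_2$ are composable, written $t_1;t_2$, if the target of $t_1$ is the source of $t_2$. A trace is a finite sequence of pairwise composable transitions $t_1;\cdots;t_n$; $\epsilon$ is the empty trace. **Causal equivalence.** $\sim$ is the least equivalence relation on traces closed under composition such that $t;t^\bullet\sim\epsilon$ for every transition $t$, and $t_1;t_2'\sim t_2;t_1'$ for any $t_1;t_2':X\overset{\theta_1}{\twoheadrightarrow}\overset{\theta_2}{\twoheadrightarrow}Y$ and $t_2;t_1':X\overset{\theta_2}{\twoheadrightarrow}\overset{\theta_1}{\twoheadrightarrow}Y$. *)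

theory Defs
  imports Main
begin

(* Names and co-names over the name set 'a; visible actions are the lambda of CCSK. *)
datatype 'a visible = Name 'a | Coname 'a

fun co :: "'a visible \<Rightarrow> 'a visible" where
  "co (Name a) = Coname a"
| "co (Coname a) = Name a"

datatype 'a label = Vis "'a visible" | Tau

datatype ('a, 'k) proc =
    Null
  | Pre "'a label" "('a, 'k) proc"
  | KPre "'a label" 'k "('a, 'k) proc"
  | Res "('a, 'k) proc" 'a
  | Sum "('a, 'k) proc" "('a, 'k) proc"
  | Par "('a, 'k) proc" "('a, 'k) proc"

primrec keys :: "('a, 'k) proc \<Rightarrow> 'k set" where
  "keys Null = {}"
| "keys (Pre \<alpha> X) = keys X"
| "keys (KPre \<alpha> k X) = insert k (keys X)"
| "keys (Res X a) = keys X"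
| "keys (Sum X Y) = keys X \<union> keys Y"
| "keys (Par X Y) = keys X \<union> keys Y"

definition std :: "('a, 'k) proc \<Rightarrow> bool" where
  "std X \<longleftrightarrow> keys X = {}"

datatype side = LeftPar | RightPar

(* Single u \<alpha> k stands for u \<alpha>[k].
   Sync u uL l uR k stands for u <|L uL l[k], |R uR (co l)[k]>; the leading |L and |R inside
   the pair are implicit, and l is visible because tau has no complement. *)
datatype ('a, 'k) plabel =
    Single "side list" "'a label" 'k
  | Sync "side list" "side list" "'a visible" "side list" 'k

fun lab :: "('a, 'k) plabel \<Rightarrow> 'a label" where
  "lab (Single u \<alpha> k) = \<alpha>"
| "lab (Sync u uL l uR k) = Tau"

fun key :: "('a, 'k) plabel \<Rightarrow> 'k" where
  "key (Single u \<alpha> k) = k"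
| "key (Sync u uL l uR k) = k"

fun push :: "side \<Rightarrow> ('a, 'k) plabel \<Rightarrow> ('a, 'k) plabel" where
  "push s (Single u \<alpha> k) = Single (s # u) \<alpha> k"
| "push s (Sync u uL l uR k) = Sync (s # u) uL l uR k"

inductive fwd :: "('a, 'k) proc \<Rightarrow> ('a, 'k) plabel \<Rightarrow> ('a, 'k) proc \<Rightarrow> bool" where
  fwd_act: "std X \<Longrightarrow> fwd (Pre \<alpha> X) (Single [] \<alpha> k) (KPre \<alpha> k X)"
| fwd_pre: "fwd X \<theta> X' \<Longrightarrow> key \<theta> \<noteq> k \<Longrightarrow> fwd (KPre \<alpha> k X) \<theta> (KPre \<alpha> k X')"
| fwd_res: "fwd X \<theta> X' \<Longrightarrow> lab \<theta> \<notin> {Vis (Name a), Vis (Coname a)}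
    \<Longrightarrow> fwd (Res X a) \<theta> (Res X' a)"
| fwd_parL: "fwd X \<theta> X' \<Longrightarrow> key \<theta> \<notin> keys Y
    \<Longrightarrow> fwd (Par X Y) (push LeftPar \<theta>) (Par X' Y)"
| fwd_parR: "fwd Y \<theta> Y' \<Longrightarrow> key \<theta> \<notin> keys X
    \<Longrightarrow> fwd (Par X Y) (push RightPar \<theta>) (Par X Y')"
| fwd_syn: "fwd X (Single uL (Vis l) k) X' \<Longrightarrow> fwd Y (Single uR (Vis (co l)) k) Y'
    \<Longrightarrow> fwd (Par X Y) (Sync [] uL l uR k) (Par X' Y')"
| fwd_sumL: "fwd X \<theta> X' \<Longrightarrow> std Y \<Longrightarrow> fwd (Sum X Y) \<theta> (Sum X' Y)"
| fwd_sumR: "fwd Y \<theta> Y' \<Longrightarrow> std X \<Longrightarrow> fwd (Sum X Y) \<theta> (Sum X Y')"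

inductive bwd :: "('a, 'k) proc \<Rightarrow> ('a, 'k) plabel \<Rightarrow> ('a, 'k) proc \<Rightarrow> bool" where
  bwd_act: "std X \<Longrightarrow> bwd (KPre \<alpha> k X) (Single [] \<alpha> k) (Pre \<alpha> X)"
| bwd_pre: "bwd X' \<theta> X \<Longrightarrow> key \<theta> \<noteq> k \<Longrightarrow> bwd (KPre \<alpha> k X') \<theta> (KPre \<alpha> k X)"
| bwd_res: "bwd X' \<theta> X \<Longrightarrow> lab \<theta> \<notin> {Vis (Name a), Vis (Coname a)}
    \<Longrightarrow> bwd (Res X' a) \<theta> (Res X a)"
| bwd_parL: "bwd X' \<theta> X \<Longrightarrow> key \<theta> \<notin> keys Y
    \<Longrightarrow> bwd (Par X' Y) (push LeftPar \<theta>) (Par X Y)"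
| bwd_parR: "bwd Y' \<theta> Y \<Longrightarrow> key \<theta> \<notin> keys X
    \<Longrightarrow> bwd (Par X Y') (push RightPar \<theta>) (Par X Y)"
| bwd_syn: "bwd X' (Single uL (Vis l) k) X \<Longrightarrow> bwd Y' (Single uR (Vis (co l)) k) Y
    \<Longrightarrow> bwd (Par X' Y') (Sync [] uL l uR k) (Par X Y)"
| bwd_sumL: "bwd X' \<theta> X \<Longrightarrow> std Y \<Longrightarrow> bwd (Sum X' Y) \<theta> (Sum X Y)"
| bwd_sumR: "bwd Y' \<theta> Y \<Longrightarrow> std X \<Longrightarrow> bwd (Sum X Y') \<theta> (Sum X Y)"

definition step :: "('a, 'k) proc \<Rightarrow> ('a, 'k) plabel \<Rightarrow> ('a, 'k) proc \<Rightarrow> bool" where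
  "step X \<theta> Y \<longleftrightarrow> fwd X \<theta> Y \<or> bwd X \<theta> Y"

definition reachable :: "('a, 'k) proc \<Rightarrow> bool" where
  "reachable X \<longleftrightarrow> (\<exists>O\<^sub>X. std O\<^sub>X \<and> (\<lambda>Y Z. \<exists>\<theta>. step Y \<theta> Z)\<^sup>*\<^sup>* O\<^sub>X X)"

datatype dir = Forward | Backward

datatype ('a, 'k) trans =
  Trans (tdir: dir) (tsource: "('a, 'k) proc") (tlabel: "('a, 'k) plabel")
    (ttarget: "('a, 'k) proc")

definition transition :: "('a, 'k) trans \<Rightarrow> bool" where
  "transition t \<longleftrightarrow> reachable (tsource t) \<and> reachable (ttarget t) \<and>
     (case tdir t of
        Forward \<Rightarrow> fwd (tsource t) (tlabel t) (ttarget t)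
      | Backward \<Rightarrow> bwd (tsource t) (tlabel t) (ttarget t))"

fun reverse :: "('a, 'k) trans \<Rightarrow> ('a, 'k) trans" where
  "reverse (Trans Forward X \<theta> X') = Trans Backward X' \<theta> X"
| "reverse (Trans Backward X \<theta> X') = Trans Forward X' \<theta> X"

(* A trace carries its source, so that source and target also make sense for the empty
   trace: (X, []) is the empty trace at X. *)
type_synonym ('a, 'k) trace = "('a, 'k) proc \<times> ('a, 'k) trans list"

abbreviation empty_trace :: "('a, 'k) proc \<Rightarrow> ('a, 'k) trace" where
  "empty_trace X \<equiv> (X, [])"

fun source :: "('a, 'k) trace \<Rightarrow> ('a, 'k) proc" where
  "source (X, ts) = X"

fun target :: "('a, 'k) trace \<Rightarrow> ('a, 'k) proc" where
  "target (X, ts) = (if ts = [] then X else ttarget (last ts))"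

fun trace :: "('a, 'k) trace \<Rightarrow> bool" where
  "trace (X, []) \<longleftrightarrow> reachable X"
| "trace (X, t # ts) \<longleftrightarrow> transition t \<and> tsource t = X \<and> trace (ttarget t, ts)"

fun tcomp :: "('a, 'k) trace \<Rightarrow> ('a, 'k) trace \<Rightarrow> ('a, 'k) trace" where
  "tcomp (X, ts) (Y, us) = (X, ts @ us)"

definition coinitial_traces :: "('a, 'k) trace \<Rightarrow> ('a, 'k) trace \<Rightarrow> bool" where
  "coinitial_traces T1 T2 \<longleftrightarrow> source T1 = source T2"

definition cofinal_traces :: "('a, 'k) trace \<Rightarrow> ('a, 'k) trace \<Rightarrow> bool" where
  "cofinal_traces T1 T2 \<longleftrightarrow> target T1 = target T2"

inductive causal_eq :: "('a, 'k) trace \<Rightarrow> ('a, 'k) trace \<Rightarrow> bool" (infix "\<sim>" 50) where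
  ce_refl: "trace T \<Longrightarrow> T \<sim> T"
| ce_sym: "T1 \<sim> T2 \<Longrightarrow> T2 \<sim> T1"
| ce_trans: "T1 \<sim> T2 \<Longrightarrow> T2 \<sim> T3 \<Longrightarrow> T1 \<sim> T3"
| ce_comp: "S1 \<sim> S2 \<Longrightarrow> T1 \<sim> T2 \<Longrightarrow> target S1 = source T1 \<Longrightarrow> target S2 = source T2
    \<Longrightarrow> tcomp S1 T1 \<sim> tcomp S2 T2"
| ce_cancel: "transition t \<Longrightarrow> (tsource t, [t, reverse t]) \<sim> empty_trace (tsource t)"
| ce_swap: "trace (X, [t1, t2']) \<Longrightarrow> trace (X, [t2, t1']) \<Longrightarrow> ttarget t2' = ttarget t1'
    \<Longrightarrow> tlabel t1 = tlabel t1' \<Longrightarrow> tlabel t2 = tlabel t2'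
    \<Longrightarrow> (X, [t1, t2']) \<sim> (X, [t2, t1'])"

end

(* Two distinct backward transitions from the same process have different keys and close to a
   diamond, and every backward transition removes a key. As in Newman's lemma, all maximal
   backward traces (rollbacks) of a process are therefore causally equivalent. A trace T from X
   to Y followed by a rollback of Y is then equivalent to any rollback of X, whether the steps of
   T go forward or backward; undoing the rollback of Y shows that T depends only on X and Y up to
   causal equivalence. *)

theory Submission imports Defs begin

section \<open>Keys, determinism and the diamond property of backward transitions\<close>

section \<open>Backward transitions\<close>

lemma fwd_imp_bwd: "fwd X \<theta> Y \<Longrightarrow> bwd Y \<theta> X"
  by (induction rule: fwd.induct) (auto intro: bwd.intros)

lemma bwd_imp_fwd: "bwd X \<theta> Y \<Longrightarrow> fwd Y \<theta> X"
  by (induction rule: bwd.induct) (auto intro: fwd.intros)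

lemma key_push [simp]: "key (push s \<theta>) = key \<theta>"
  by (cases \<theta>) auto

lemma finite_keys [simp]: "finite (keys X)"
  by (induction X) auto

text \<open>The side conditions keep the undone key out of everything that remains: standardness for
  \<open>bwd_act\<close> and sums, key freshness for prefixes and one-sided parallel steps. A
  synchronisation removes its key from both components.\<close>

lemma bwd_keys: "bwd X \<theta> Y \<Longrightarrow> keys X = insert (key \<theta>) (keys Y) \<and> key \<theta> \<notin> keys Y"
  by (induction rule: bwd.induct) (auto simp: std_def)

lemma bwd_not_std: "bwd X \<theta> Y \<Longrightarrow> \<not> std X"
  using bwd_keys by (fastforce simp: std_def)

lemma bwd_key_mem: "bwd X \<theta> Y \<Longrightarrow> key \<theta> \<in> keys X"
  using bwd_keys by fastforce

lemma bwd_keys_subset: "bwd X \<theta> Y \<Longrightarrow> k \<notin> keys X \<Longrightarrow> k \<notin> keys Y"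
  using bwd_keys by fastforce

inductive_cases bwd_ResE: "bwd (Res X a) \<theta> Y"
inductive_cases bwd_KPreE [consumes 1, case_names Act Pre]: "bwd (KPre \<alpha> k X) \<theta> Y"
inductive_cases bwd_SumE [consumes 1, case_names SumL SumR]: "bwd (Sum X1 X2) \<theta> Y"
inductive_cases bwd_ParE [consumes 1, case_names ParL ParR Syn]: "bwd (Par X1 X2) \<theta> Y"

text \<open>The key reveals the rule. In a parallel process it occurs only on the left, only on the
  right, or on both sides, according to whether \<open>bwd_parL\<close>, \<open>bwd_parR\<close> or
  \<open>bwd_syn\<close> was used. For keyed prefixes and sums, competing rules clash because a
  standard process has no backward transition.\<close>

lemma bwd_key_deterministic:
  "bwd X \<theta>\<^sub>1 X\<^sub>1 \<Longrightarrow> bwd X \<theta>\<^sub>2 X\<^sub>2 \<Longrightarrow> key \<theta>\<^sub>1 = key \<theta>\<^sub>2 \<Longrightarrow> \<theta>\<^sub>1 = \<theta>\<^sub>2 \<and> X\<^sub>1 = X\<^sub>2"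
proof (induction arbitrary: \<theta>\<^sub>2 X\<^sub>2 rule: bwd.induct)
  case (bwd_act X \<alpha> k)
  then show ?case by (auto elim!: bwd_KPreE dest: bwd_not_std)
next
  case (bwd_pre X' \<theta> X k \<alpha>)
  from bwd_pre.prems(1) show ?case
  proof (cases rule: bwd_KPreE)
    case Act
    with bwd_pre.hyps bwd_not_std show ?thesis by blast
  next
    case (Pre Z)
    with bwd_pre.IH[OF Pre(2) bwd_pre.prems(2)] show ?thesis by simp
  qed
next
  case (bwd_res X' \<theta> X a)
  from bwd_res.prems(1) obtain Z where Z: "X\<^sub>2 = Res Z a" "bwd X' \<theta>\<^sub>2 Z"
    by (auto elim: bwd_ResE)
  with bwd_res.IH[OF Z(2) bwd_res.prems(2)] show ?case by simp
next
  case (bwd_parL X' \<theta> X Y)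
  from bwd_parL.prems(1) show ?case
  proof (cases rule: bwd_ParE)
    case (ParL \<theta>' Z)
    with bwd_parL.IH[OF ParL(3)] bwd_parL.prems(2) show ?thesis by simp
  next
    case (ParR \<theta>' Z)
    with bwd_parL.hyps bwd_parL.prems(2) bwd_key_mem[OF ParR(3)] show ?thesis by simp
  next
    case (Syn uL l k Z uR Z')
    with bwd_parL.hyps bwd_parL.prems(2) bwd_key_mem[OF Syn(4)] show ?thesis by simp
  qed
next
  case (bwd_parR Y' \<theta> Y X)
  from bwd_parR.prems(1) show ?case
  proof (cases rule: bwd_ParE)
    case (ParL \<theta>' Z)
    with bwd_parR.hyps bwd_parR.prems(2) bwd_key_mem[OF ParL(3)] show ?thesis by simp
  next
    case (ParR \<theta>' Z)
    with bwd_parR.IH[OF ParR(3)] bwd_parR.prems(2) show ?thesis by simp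
  next
    case (Syn uL l k Z uR Z')
    with bwd_parR.hyps bwd_parR.prems(2) bwd_key_mem[OF Syn(3)] show ?thesis by simp
  qed
next
  case (bwd_syn X' uL l k X Y' uR Y)
  from bwd_syn.prems(1) show ?case
  proof (cases rule: bwd_ParE)
    case (ParL \<theta>' Z)
    with bwd_syn.prems(2) bwd_key_mem[OF bwd_syn.hyps(2)] show ?thesis by simp
  next
    case (ParR \<theta>' Z)
    with bwd_syn.prems(2) bwd_key_mem[OF bwd_syn.hyps(1)] show ?thesis by simp
  next
    case (Syn uL' l' k' Z uR' Z')
    with bwd_syn.IH(1)[OF Syn(3)] bwd_syn.IH(2)[OF Syn(4)] bwd_syn.prems(2) show ?thesis by simp
  qed
next
  case (bwd_sumL X' \<theta> X Y)
  from bwd_sumL.prems(1) show ?case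
  proof (cases rule: bwd_SumE)
    case (SumL Z)
    with bwd_sumL.IH[OF SumL(2) bwd_sumL.prems(2)] show ?thesis by simp
  next
    case (SumR Z)
    with bwd_sumL.hyps bwd_not_std show ?thesis by blast
  qed
next
  case (bwd_sumR Y' \<theta> Y X)
  from bwd_sumR.prems(1) show ?case
  proof (cases rule: bwd_SumE)
    case (SumL Z)
    with bwd_sumR.hyps bwd_not_std show ?thesis by blast
  next
    case (SumR Z)
    with bwd_sumR.IH[OF SumR(2) bwd_sumR.prems(2)] show ?thesis by simp
  qed
qed

text \<open>Steps in different components commute, and steps in the same component are closed by
  induction. The freshness side conditions survive because backward transitions only remove
  keys.\<close>

lemma bwd_diamond:
  "bwd X \<theta>\<^sub>1 X\<^sub>1 \<Longrightarrow> bwd X \<theta>\<^sub>2 X\<^sub>2 \<Longrightarrow> key \<theta>\<^sub>1 \<noteq> key \<theta>\<^sub>2 \<Longrightarrow> \<exists>Y. bwd X\<^sub>1 \<theta>\<^sub>2 Y \<and> bwd X\<^sub>2 \<theta>\<^sub>1 Y"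
proof (induction arbitrary: \<theta>\<^sub>2 X\<^sub>2 rule: bwd.induct)
  case (bwd_act X \<alpha> k)
  \<comment> \<open>The body is standard, so the other step is also \<open>bwd_act\<close>; its key
    would then be \<open>k\<close> again, against the assumption.\<close>
  then show ?case by (auto elim!: bwd_KPreE dest: bwd_not_std)
next
  case (bwd_pre X' \<theta> X k \<alpha>)
  from bwd_pre.prems(1) show ?case
  proof (cases rule: bwd_KPreE)
    case Act
    with bwd_pre.hyps bwd_not_std show ?thesis by blast
  next
    case (Pre Z)
    with bwd_pre obtain Y where "bwd X \<theta>\<^sub>2 Y" "bwd Z \<theta> Y" by blast
    with Pre bwd_pre.hyps show ?thesis by (blast intro: bwd.bwd_pre)
  qed
next
  case (bwd_res X' \<theta> X a)
  from bwd_res.prems(1) obtain Z where Z: "X\<^sub>2 = Res Z a" "bwd X' \<theta>\<^sub>2 Z"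
      "lab \<theta>\<^sub>2 \<notin> {Vis (Name a), Vis (Coname a)}"
    by (auto elim: bwd_ResE)
  with bwd_res obtain Y where "bwd X \<theta>\<^sub>2 Y" "bwd Z \<theta> Y" by blast
  with Z bwd_res.hyps show ?case by (blast intro: bwd.bwd_res)
next
  case (bwd_parL X' \<theta> X Y)
  from bwd_parL.prems(1) show ?case
  proof (cases rule: bwd_ParE)
    case (ParL \<theta>' Z)
    with bwd_parL obtain W where "bwd X \<theta>' W" "bwd Z \<theta> W" by (metis key_push)
    with ParL bwd_parL.hyps show ?thesis by (blast intro: bwd.bwd_parL)
  next
    case (ParR \<theta>' Z)
    note bwd_keys_subset[OF bwd_parL.hyps(1) ParR(4)] bwd_keys_subset[OF ParR(3) bwd_parL.hyps(2)]
    with ParR bwd_parL.hyps have "bwd (Par X Y) \<theta>\<^sub>2 (Par X Z)"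
        "bwd X\<^sub>2 (push LeftPar \<theta>) (Par X Z)"
      by (simp_all add: bwd.bwd_parL bwd.bwd_parR)
    then show ?thesis by blast
  next
    case (Syn uL l k Z uR Z')
    \<comment> \<open>Only the left component takes part in both steps, so the induction hypothesis
      is used there. The right component just performs its half of the synchronisation and gains no
      key.\<close>
    with bwd_parL obtain W where "bwd X (Single uL (Vis l) k) W" "bwd Z \<theta> W"
      by (metis key.simps key_push)
    moreover note bwd_keys_subset[OF Syn(4) bwd_parL.hyps(2)]
    ultimately have "bwd (Par X Y) \<theta>\<^sub>2 (Par W Z')" "bwd X\<^sub>2 (push LeftPar \<theta>) (Par W Z')"
      using Syn by (simp_all add: bwd.bwd_parL bwd.bwd_syn)
    then show ?thesis by blast
  qed
next
  case (bwd_parR Y' \<theta> Y X)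
  from bwd_parR.prems(1) show ?case
  proof (cases rule: bwd_ParE)
    case (ParL \<theta>' Z)
    note bwd_keys_subset[OF bwd_parR.hyps(1) ParL(4)] bwd_keys_subset[OF ParL(3) bwd_parR.hyps(2)]
    with ParL bwd_parR.hyps have "bwd (Par X Y) \<theta>\<^sub>2 (Par Z Y)"
        "bwd X\<^sub>2 (push RightPar \<theta>) (Par Z Y)"
      by (simp_all add: bwd.bwd_parL bwd.bwd_parR)
    then show ?thesis by blast
  next
    case (ParR \<theta>' Z)
    with bwd_parR obtain W where "bwd Y \<theta>' W" "bwd Z \<theta> W" by (metis key_push)
    with ParR bwd_parR.hyps show ?thesis by (blast intro: bwd.bwd_parR)
  next
    case (Syn uL l k Z uR Z')
    with bwd_parR obtain W where "bwd Y (Single uR (Vis (co l)) k) W" "bwd Z' \<theta> W"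
      by (metis key.simps key_push)
    moreover note bwd_keys_subset[OF Syn(3) bwd_parR.hyps(2)]
    ultimately have "bwd (Par X Y) \<theta>\<^sub>2 (Par Z W)" "bwd X\<^sub>2 (push RightPar \<theta>) (Par Z W)"
      using Syn by (simp_all add: bwd.bwd_parR bwd.bwd_syn)
    then show ?thesis by blast
  qed
next
  case (bwd_syn X' uL l k X Y' uR Y)
  from bwd_syn.prems(1) show ?case
  proof (cases rule: bwd_ParE)
    case (ParL \<theta>' Z)
    with bwd_syn obtain W where "bwd X \<theta>' W" "bwd Z (Single uL (Vis l) k) W"
      by (metis key.simps key_push)
    moreover note bwd_keys_subset[OF bwd_syn.hyps(2) ParL(4)]
    ultimately have "bwd (Par X Y) \<theta>\<^sub>2 (Par W Y)" "bwd X\<^sub>2 (Sync [] uL l uR k) (Par W Y)"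
      using ParL bwd_syn.hyps by (simp_all add: bwd.bwd_parL bwd.bwd_syn)
    then show ?thesis by blast
  next
    case (ParR \<theta>' Z)
    with bwd_syn obtain W where "bwd Y \<theta>' W" "bwd Z (Single uR (Vis (co l)) k) W"
      by (metis key.simps key_push)
    moreover note bwd_keys_subset[OF bwd_syn.hyps(1) ParR(4)]
    ultimately have "bwd (Par X Y) \<theta>\<^sub>2 (Par X W)" "bwd X\<^sub>2 (Sync [] uL l uR k) (Par X W)"
      using ParR bwd_syn.hyps by (simp_all add: bwd.bwd_parR bwd.bwd_syn)
    then show ?thesis by blast
  next
    case (Syn uL' l' k' Z uR' Z')
    with bwd_syn obtain W W' where
      "bwd X (Single uL' (Vis l') k') W" "bwd Z (Single uL (Vis l) k) W"
      "bwd Y (Single uR' (Vis (co l')) k') W'" "bwd Z' (Single uR (Vis (co l)) k) W'"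
      by (metis key.simps)
    with Syn show ?thesis by (blast intro: bwd.bwd_syn)
  qed
next
  case (bwd_sumL X' \<theta> X Y)
  from bwd_sumL.prems(1) show ?case
    using bwd_sumL.IH bwd_sumL.hyps bwd_sumL.prems(2)
    by (cases rule: bwd_SumE) (blast dest: bwd_not_std intro: bwd.bwd_sumL)+
next
  case (bwd_sumR Y' \<theta> Y X)
  from bwd_sumR.prems(1) show ?case
    using bwd_sumR.IH bwd_sumR.hyps bwd_sumR.prems(2)
    by (cases rule: bwd_SumE) (blast dest: bwd_not_std intro: bwd.bwd_sumR)+
qed

section \<open>Congruence of causal equivalence and the undoing of traces\<close>

section \<open>Traces up to causal equivalence\<close>

lemma reachable_bwd: "reachable X \<Longrightarrow> bwd X \<theta> Y \<Longrightarrow> reachable Y"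
  unfolding reachable_def step_def
  by (elim exE conjE) (rule exI, erule conjI, erule rtranclp.rtrancl_into_rtrancl, blast)

lemma transition_Backward:
  "reachable X \<Longrightarrow> bwd X \<theta> Y \<Longrightarrow> transition (Trans Backward X \<theta> Y)"
  by (simp add: transition_def reachable_bwd)

lemma reverse_ends [simp]: "tsource (reverse t) = ttarget t" "ttarget (reverse t) = tsource t"
  by (cases t rule: reverse.cases; simp)+

lemma causal_eq_append:
  assumes "(X, ts) \<sim> (X, ts')" "(Y, us) \<sim> (Y, us')" "target (X, ts) = Y" "target (X, ts') = Y"
  shows "(X, ts @ us) \<sim> (X, ts' @ us')"
  using ce_comp[OF assms(1,2)] assms(3,4) by simp

lemma causal_eq_Cons:
  assumes "transition t" "(ttarget t, ts) \<sim> (ttarget t, us)"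
  shows "(tsource t, t # ts) \<sim> (tsource t, t # us)"
proof -
  have "(tsource t, [t]) \<sim> (tsource t, [t])"
    using assms(1) by (intro ce_refl) (auto simp: transition_def)
  from causal_eq_append[OF this assms(2)] show ?thesis by simp
qed

lemma causal_eq_cancel_Cons:
  assumes "transition t" "trace (tsource t, ts)"
  shows "(tsource t, t # reverse t # ts) \<sim> (tsource t, ts)"
  using causal_eq_append[OF ce_cancel[OF assms(1)] ce_refl[OF assms(2)]] by simp

lemma target_tcomp: "target S = source T \<Longrightarrow> target (tcomp S T) = target T"
  by (cases S; cases T) auto

lemma causal_eq_target: "S \<sim> T \<Longrightarrow> target S = target T"
  by (induction rule: causal_eq.induct) (simp_all add: target_tcomp)

text \<open>Replaces the description of the target by \<open>last\<close> with the recursion of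
  \<open>trace\<close>, as inductions along a trace require.\<close>

lemma target_Cons: "target (X, t # ts) = target (ttarget t, ts)"
  by simp

lemma reachable_target: "trace (X, ts) \<Longrightarrow> reachable (target (X, ts))"
  by (induction ts arbitrary: X) (auto simp: target_Cons simp del: target.simps, simp)

lemma trace_append:
  "trace (X, ts) \<Longrightarrow> trace (target (X, ts), us) \<Longrightarrow> trace (X, ts @ us)"
  by (induction ts arbitrary: X) (simp_all split: if_splits)

lemma transition_reverse: "transition t \<Longrightarrow> transition (reverse t)"
  by (cases t rule: reverse.cases) (auto simp: transition_def fwd_imp_bwd bwd_imp_fwd)

lemma trace_reverse:
  assumes "transition t"
  shows "trace (ttarget t, [reverse t])"
  using transition_reverse[OF assms] assms by (auto simp: transition_def)

lemma target_undo: "trace (X, ts) \<Longrightarrow> target (target (X, ts), rev (map reverse ts)) = X"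
  by (cases ts) auto

lemma trace_undo: "trace (X, ts) \<Longrightarrow> trace (target (X, ts), rev (map reverse ts))"
proof (induction ts arbitrary: X)
  case (Cons t ts)
  then have t: "transition t" and ts: "trace (ttarget t, ts)" by auto
  have "trace (target (ttarget t, ts), rev (map reverse ts) @ [reverse t])"
    using Cons.IH[OF ts] trace_reverse[OF t] target_undo[OF ts] by (intro trace_append) simp_all
  then show ?case by (simp only: target_Cons list.map rev.simps)
qed simp

text \<open>Cancellation proceeds from the inside: by induction \<open>ts\<close> meets its own
  undoing, which leaves \<open>t\<close> next to \<open>reverse t\<close>.\<close>

lemma causal_eq_undo:
  "trace (X, ts) \<Longrightarrow> (X, ts @ rev (map reverse ts)) \<sim> (X, [])"
proof (induction ts arbitrary: X)
  case Nil
  then show ?case by (simp add: ce_refl)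
next
  case (Cons t ts)
  then have t: "transition t" "tsource t = X" by auto
  have "trace (ttarget t, [reverse t])"
    using t(1) by (rule trace_reverse)
  moreover have "(ttarget t, ts @ rev (map reverse ts)) \<sim> (ttarget t, [])"
    using Cons by simp
  moreover have "target (ttarget t, ts @ rev (map reverse ts)) = ttarget t"
    using Cons.prems by (cases ts) auto
  ultimately have "(ttarget t, (ts @ rev (map reverse ts)) @ [reverse t])
      \<sim> (ttarget t, [] @ [reverse t])"
    by (intro causal_eq_append ce_refl) auto
  from causal_eq_Cons[OF t(1) this] ce_cancel[OF t(1)] show ?case
    using t(2) ce_trans by fastforce
qed

section \<open>Maximal backward traces and the absorption of arbitrary traces into them\<close>

section \<open>Rollbacks\<close>

inductive rollback :: "('a, 'k) proc \<Rightarrow> ('a, 'k) trans list \<Rightarrow> bool" where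
  rollback_Nil: "reachable X \<Longrightarrow> (\<And>\<theta> Y. \<not> bwd X \<theta> Y) \<Longrightarrow> rollback X []"
| rollback_Cons: "reachable X \<Longrightarrow> bwd X \<theta> Y \<Longrightarrow> rollback Y ts
    \<Longrightarrow> rollback X (Trans Backward X \<theta> Y # ts)"

lemma rollback_trace: "rollback X ts \<Longrightarrow> trace (X, ts)"
  by (induction rule: rollback.induct) (auto simp: transition_Backward)

lemma bwd_card_keys: "bwd X \<theta> Y \<Longrightarrow> card (keys Y) < card (keys X)"
  using bwd_keys by fastforce

lemma rollback_exists: "reachable X \<Longrightarrow> \<exists>ts. rollback X ts"
  by (induction "card (keys X)" arbitrary: X rule: less_induct)
    (metis bwd_card_keys reachable_bwd rollback.intros)

text \<open>Well-founded induction on the number of keys, which drops along each backward step. It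
  compares the first steps of the two rollbacks: equal keys force the same step, different keys give
  a diamond.\<close>

lemma rollback_causal_eq: "rollback X ts \<Longrightarrow> rollback X us \<Longrightarrow> (X, ts) \<sim> (X, us)"
proof (induction "card (keys X)" arbitrary: X ts us rule: less_induct)
  case less
  have IH: "(Y, ts') \<sim> (Y, us')"
    if "bwd X \<theta> Y" "rollback Y ts'" "rollback Y us'" for \<theta> Y ts' us'
    using less.hyps that bwd_card_keys by blast
  show ?case
    using less.prems(1)
  proof cases
    case rollback_Nil
    with less.prems(2) have "us = []" by (auto elim: rollback.cases)
    with rollback_Nil show ?thesis by (simp add: ce_refl)
  next
    case ts: (rollback_Cons \<theta>\<^sub>1 X\<^sub>1 ts')
    let ?t\<^sub>1 = "Trans Backward X \<theta>\<^sub>1 X\<^sub>1"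
    have t\<^sub>1: "transition ?t\<^sub>1" using ts by (simp add: transition_Backward)
    show ?thesis
      using less.prems(2)
    proof cases
      case rollback_Nil
      with ts show ?thesis by blast
    next
      case us: (rollback_Cons \<theta>\<^sub>2 X\<^sub>2 us')
      let ?t\<^sub>2 = "Trans Backward X \<theta>\<^sub>2 X\<^sub>2"
      have t\<^sub>2: "transition ?t\<^sub>2" using us by (simp add: transition_Backward)
      show ?thesis
      proof (cases "key \<theta>\<^sub>1 = key \<theta>\<^sub>2")
        case True
        with ts us have "\<theta>\<^sub>1 = \<theta>\<^sub>2" "X\<^sub>1 = X\<^sub>2" using bwd_key_deterministic by blast+
        with ts us IH causal_eq_Cons[OF t\<^sub>1] show ?thesis by simp
      next
        case False
        with ts us obtain Y where Y: "bwd X\<^sub>1 \<theta>\<^sub>2 Y" "bwd X\<^sub>2 \<theta>\<^sub>1 Y"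
          using bwd_diamond by blast
        have reach: "reachable X\<^sub>1" "reachable X\<^sub>2" "reachable Y"
          using ts us Y reachable_bwd by blast+
        \<comment> \<open>A rollback of the far corner \<open>Y\<close> extends to rollbacks of both
          \<open>X\<^sub>1\<close> and \<open>X\<^sub>2\<close>. The induction hypothesis at these
          two states lets it replace the tails \<open>ts'\<close> and \<open>us'\<close>, so that
          only the two sides of the diamond remain to be swapped.\<close>
        then obtain vs where vs: "rollback Y vs" using rollback_exists by blast
        let ?u\<^sub>1 = "Trans Backward X\<^sub>2 \<theta>\<^sub>1 Y" and ?u\<^sub>2 = "Trans Backward X\<^sub>1 \<theta>\<^sub>2 Y"
        have "(X\<^sub>1, ts') \<sim> (X\<^sub>1, ?u\<^sub>2 # vs)" "(X\<^sub>2, ?u\<^sub>1 # vs) \<sim> (X\<^sub>2, us')"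
          using IH ts us Y reach vs by (blast intro: rollback_Cons)+
        then have "(X, ?t\<^sub>1 # ts') \<sim> (X, ?t\<^sub>1 # ?u\<^sub>2 # vs)"
          and "(X, ?t\<^sub>2 # ?u\<^sub>1 # vs) \<sim> (X, ?t\<^sub>2 # us')"
          using causal_eq_Cons[OF t\<^sub>1] causal_eq_Cons[OF t\<^sub>2] by simp_all
        moreover have "(X, [?t\<^sub>1, ?u\<^sub>2]) \<sim> (X, [?t\<^sub>2, ?u\<^sub>1])"
          using t\<^sub>1 t\<^sub>2 Y reach by (intro ce_swap) (auto simp: transition_Backward)
        from causal_eq_append[OF this ce_refl[OF rollback_trace[OF vs]]]
        have "(X, ?t\<^sub>1 # ?u\<^sub>2 # vs) \<sim> (X, ?t\<^sub>2 # ?u\<^sub>1 # vs)" by simp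
        ultimately show ?thesis using ts us ce_trans by blast
      qed
    qed
  qed
qed

text \<open>Appending a rollback makes a trace forget its route. The induction peels off the first
  transition: a backward one extends a rollback of its target, a forward one is cancelled by a
  rollback that starts with its reverse.\<close>

lemma trace_rollback_causal_eq:
  "trace (X, ts) \<Longrightarrow> rollback (target (X, ts)) us \<Longrightarrow> rollback X vs \<Longrightarrow> (X, ts @ us) \<sim> (X, vs)"
proof (induction ts arbitrary: X vs)
  case Nil
  then show ?case by (simp add: rollback_causal_eq)
next
  case (Cons t ts)
  then have t: "transition t" "tsource t = X" and ts: "trace (ttarget t, ts)"
    and us: "rollback (target (ttarget t, ts)) us" by auto
  have reach: "reachable X" "reachable (ttarget t)" using t by (auto simp: transition_def)
  then obtain ws where ws: "rollback (ttarget t) ws" using rollback_exists by blast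
  \<comment> \<open>The rollback \<open>ws'\<close> stays arbitrary because the two directions of
    \<open>t\<close> choose it differently: \<open>ws\<close> if backward,
    \<open>reverse t # vs\<close> if forward.\<close>
  have *: "(X, t # ts @ us) \<sim> (X, t # ws')" if "rollback (ttarget t) ws'" for ws'
    using causal_eq_Cons[OF t(1) Cons.IH[OF ts us that]] t(2) by simp
  show ?case
  proof (cases "tdir t")
    case Backward
    with t have "t = Trans Backward X (tlabel t) (ttarget t)" "bwd X (tlabel t) (ttarget t)"
      by (cases t; auto simp: transition_def)+
    then have "rollback X (t # ws)" using reach ws rollback_Cons by metis
    then show ?thesis
      using *[OF ws] rollback_causal_eq Cons.prems(3) ce_trans by fastforce
  next
    case Forward
    with t have "reverse t = Trans Backward (ttarget t) (tlabel t) X"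
      "bwd (ttarget t) (tlabel t) X"
      by (cases t; auto simp: transition_def fwd_imp_bwd)+
    then have "rollback (ttarget t) (reverse t # vs)"
      using reach Cons.prems(3) rollback_Cons by metis
    moreover have "(X, t # reverse t # vs) \<sim> (X, vs)"
      using causal_eq_cancel_Cons[OF t(1)] t(2) rollback_trace[OF Cons.prems(3)] by simp
    ultimately show ?thesis using * ce_trans by fastforce
  qed
qed

theorem theorem4:
  fixes T1 T2 :: "('a, 'k) trace"
  assumes "trace T1" and "trace T2"
    and "coinitial_traces T1 T2" and "cofinal_traces T1 T2"
  shows "T1 \<sim> T2"
proof -
  obtain X ts us where T: "T1 = (X, ts)" "T2 = (X, us)"
    using assms(3) by (cases T1; cases T2) (auto simp: coinitial_traces_def)
  define Y where "Y = target (X, ts)"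
  have Y: "target (X, ts) = Y" "target (X, us) = Y"
    using assms(4) by (simp_all only: T Y_def cofinal_traces_def)
  have reach: "reachable X" "reachable Y"
    using assms(1) reachable_target[of X ts] Y(1) T by (cases ts; auto simp: transition_def)+
  then obtain vs ws where vs: "rollback X vs" and ws: "rollback Y ws"
    using rollback_exists by blast
  let ?ws' = "rev (map reverse ws)"
  have undo: "(Y, ws @ ?ws') \<sim> (Y, [])"
    using causal_eq_undo rollback_trace[OF ws] by blast
  \<comment> \<open>The right-hand side does not mention \<open>rs\<close>: it rolls
    \<open>X\<close> back completely and then climbs to \<open>Y\<close> by undoing the rollback
    \<open>ws\<close>.\<close>
  have normal_form: "(X, rs) \<sim> (X, vs @ ?ws')" if "trace (X, rs)" "target (X, rs) = Y" for rs
  proof -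
    have rs: "(X, rs @ ws) \<sim> (X, vs)"
      using trace_rollback_causal_eq that vs ws by blast
    have target_rs: "target (X, rs @ ws) = target (Y, ws)"
      using that(2) by auto
    have "(target (Y, ws), ?ws') \<sim> (target (Y, ws), ?ws')"
      by (intro ce_refl trace_undo rollback_trace ws)
    \<comment> \<open>Appending \<open>?ws'\<close> to \<open>vs\<close> requires \<open>vs\<close>
      to end where \<open>ws\<close> does; this holds because causally equivalent traces have equal
      targets.\<close>
    from causal_eq_append[OF rs this target_rs] causal_eq_target[OF rs] target_rs
    have "(X, rs @ ws @ ?ws') \<sim> (X, vs @ ?ws')" by simp
    \<comment> \<open>The detour \<open>ws @ ?ws'\<close> is a loop at \<open>Y\<close> equivalent
      to the empty trace, so it may be inserted after \<open>rs\<close>.\<close>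
    moreover have "(X, rs) \<sim> (X, rs @ ws @ ?ws')"
      using causal_eq_append[OF ce_refl[OF that(1)] ce_sym[OF undo] that(2,2)] by simp
    ultimately show ?thesis using ce_trans by blast
  qed
  show ?thesis
    using normal_form assms(1,2) T Y ce_sym ce_trans by metis
qed

end
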